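(* Consider the zeroth-order dynamics $$\dot\phi_{\mathrm I}(t)=-iH_{\mathrm I,\mathrm I}\,\phi_{\mathrm I}(t)-iE^{T}ME\,\phi_{\mathrm I}(t),\qquad \phi_{\mathrm I}(t)\in\mathbb C^{n_{\mathrm I}},$$ where $M$ is a constant $n_\Gamma\times n_\Gamma$ matrix, restricted to be a Hermitian matrix. This dynamics is stable if $M$ is chosen as $K(s_0)$ for an arbitrary positive value of $s_0$ ($s_0\ge 0$), where $$K(s)=-H_{\Gamma,\mathrm{II}}\,\big(H_{\mathrm{II},\mathrm{II}}-isI\big)^{-1}H_{\mathrm{II},\Gamma}.$$
   Context: Setting. A time-dependent Schrödinger equation $i\partial_t\phi=\hat H\phi$, $\hat H=-\frac{\nabla^2}{2}+V$, on $\Omega=\Omega_{\mathrm I}\cup\Omega_{\mathrm{II}}\subset\mathbb R^d$, with $V$ zero (or constant) in the exterior $\Omega_{\mathrm{II}}$, is discretized in space by finite differences on a uniform grid with $n_{\mathrm I}$ points in the interior $\Omega_{\mathrm I}$ and $n_{\mathrm{II}}$ points in $\Omega_{\mathrm{II}}$ ($n_{\mathrm{II}}$ can be infinite). The discretized Hamiltonian is Hermitian with block form $$H=\begin{bmatrix}H_{\mathrm I,\mathrm I}&H_{\mathrm I,\mathrm{II}}\\ H_{\mathrm{II},\mathrm I}&H_{\mathrm{II},\mathrm{II}}\end{bmatrix},$$ so that the semi-discrete model is $i\dot\phi_{\mathrm I}=H_{\mathrm I,\mathrm I}\phi_{\mathrm I}+H_{\mathrm I,\mathrm{II}}\phi_{\mathrm{II}}$,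 $i\dot\phi_{\mathrm{II}}=H_{\mathrm{II},\mathrm I}\phi_{\mathrm I}+H_{\mathrm{II},\mathrm{II}}\phi_{\mathrm{II}}$, with $\phi_{\mathrm{II}}(0)=0$. The block $H_{\mathrm I,\mathrm I}$ can be a nonlinear operator. Boundary set. $\Gamma\subset\Omega_{\mathrm I}$ is the set of interior grid points $x_j$ for which there is an exterior grid point $x_k\in\Omega_{\mathrm{II}}$ with $H_{jk}\neq0$; $n_\Gamma$ is the number of its points. The points of $\Omega_{\mathrm I}$ are ordered so that those of $\Gamma$ come first, and $E=[\,I_{n_\Gamma}\;\;0\,]\in\mathbb R^{n_\Gamma\times n_{\mathrm I}}$ is the restriction to $\Gamma$. Then $H_{\mathrm{II},\Gamma}=H_{\mathrm{II},\mathrm I}E^T$ and $H_{\mathrm I,\mathrm{II}}=E^TH_{\Gamma,\mathrm{II}}$. The function $K(s)$ is the discrete Dirichlet-to-Neumann map in the Laplace domain: the Laplace transforms of $f_\Gamma=H_{\Gamma,\mathrm{II}}\phi_{\mathrm{II}}$ and $\phi_\Gamma=E\phi_{\mathrm I}$ satisfy $F_\Gamma(s)=K(s)\Phi_\Gamma(s)$. The zeroth-order approximation replaces $K(s)$ by the constant matrix $M$. Stability is understood in the sense of Lyapunov, for the zero solution of the system. *)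

theory Defs
  imports "HOL-Analysis.Analysis"
begin

text \<open>
  The finite type \<open>'i\<close> indexes the interior grid points and the type \<open>'e\<close>, which may be infinite,
  the exterior ones. Matrices with a possibly infinite or set-indexed side are functions of two
  indices; functions on the exterior grid live in \<open>l2\<close>.
\<close>

definition hermitian_matrix :: "('a \<Rightarrow> 'a \<Rightarrow> complex) \<Rightarrow> bool" where
  "hermitian_matrix H \<longleftrightarrow> (\<forall>j k. H j k = cnj (H k j))"

text \<open>
  What is used of the finite difference method on a uniform grid, beyond hermiticity: stencils of
  bounded size and bounded coefficients. Every finite matrix has this property; an infinite
  Hermitian one with it acts on \<open>l2\<close> as a bounded self-adjoint operator.
\<close>

definition finite_difference_matrix :: "('a \<Rightarrow> 'a \<Rightarrow> complex) \<Rightarrow> bool" where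
  "finite_difference_matrix H \<longleftrightarrow>
     (\<exists>N C. \<forall>j. finite {k. H j k \<noteq> 0} \<and> card {k. H j k \<noteq> 0} \<le> N \<and> (\<forall>k. cmod (H j k) \<le> C))"

fun block_matrix ::
  "('i \<Rightarrow> 'i \<Rightarrow> complex) \<Rightarrow> ('i \<Rightarrow> 'e \<Rightarrow> complex) \<Rightarrow> ('e \<Rightarrow> 'i \<Rightarrow> complex) \<Rightarrow> ('e \<Rightarrow> 'e \<Rightarrow> complex) \<Rightarrow>
     'i + 'e \<Rightarrow> 'i + 'e \<Rightarrow> complex" where
  "block_matrix A B C D (Inl i) (Inl j) = A i j"
| "block_matrix A B C D (Inl i) (Inr k) = B i k"
| "block_matrix A B C D (Inr k) (Inl i) = C k i"
| "block_matrix A B C D (Inr k) (Inr l) = D k l"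

definition l2 :: "('e \<Rightarrow> complex) set" where
  "l2 = {u. (\<lambda>k. (cmod (u k))\<^sup>2) summable_on UNIV}"

definition shifted_op :: "('e \<Rightarrow> 'e \<Rightarrow> complex) \<Rightarrow> complex \<Rightarrow> ('e \<Rightarrow> complex) \<Rightarrow> 'e \<Rightarrow> complex" where
  "shifted_op A z u = (\<lambda>k. (\<Sum>\<^sub>\<infinity>l. A k l * u l) - z * u k)"

definition shifted_op_invertible :: "('e \<Rightarrow> 'e \<Rightarrow> complex) \<Rightarrow> complex \<Rightarrow> bool" where
  "shifted_op_invertible A z \<longleftrightarrow> bij_betw (shifted_op A z) l2 l2"

definition resolvent :: "('e \<Rightarrow> 'e \<Rightarrow> complex) \<Rightarrow> complex \<Rightarrow> ('e \<Rightarrow> complex) \<Rightarrow> 'e \<Rightarrow> complex" where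
  "resolvent A z = inv_into l2 (shifted_op A z)"

definition boundary_set :: "('i \<Rightarrow> 'e \<Rightarrow> complex) \<Rightarrow> 'i set" where
  "boundary_set H_I_II = {j. \<exists>k. H_I_II j k \<noteq> 0}"

text \<open>
  The restriction matrix \<open>E\<close>: its row index ranges over \<open>\<Gamma>\<close> only, so every sum over a row index of
  \<open>E\<close> is a sum over \<open>\<Gamma>\<close>. Rows and columns are labelled by grid points, so no ordering is needed.
\<close>

definition restriction :: "'i \<Rightarrow> 'i \<Rightarrow> complex" where
  "restriction g j = (if g = j then 1 else 0)"

definition H_Gamma_II :: "('i::finite \<Rightarrow> 'e \<Rightarrow> complex) \<Rightarrow> 'i \<Rightarrow> 'e \<Rightarrow> complex" where
  "H_Gamma_II H_I_II g k = (\<Sum>j\<in>UNIV. restriction g j * H_I_II j k)"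

definition H_II_Gamma :: "('e \<Rightarrow> 'i::finite \<Rightarrow> complex) \<Rightarrow> 'e \<Rightarrow> 'i \<Rightarrow> complex" where
  "H_II_Gamma H_II_I k g = (\<Sum>j\<in>UNIV. H_II_I k j * restriction g j)"

text \<open>The Dirichlet-to-Neumann map \<open>K(s)\<close>; only its entries with indices in \<open>\<Gamma>\<close> are meaningful.
  For real \<open>s > 0\<close> and nonempty \<open>\<Gamma>\<close> it is not Hermitian (\<open>\<i> (K - K\<^sup>*)\<close> is nonzero and positive semidefinite), so a matrix
  \<open>M = K(s)\<close> cannot also be required to be Hermitian without voiding that case.\<close>

definition DtN_map ::
  "('i::finite \<Rightarrow> 'e \<Rightarrow> complex) \<Rightarrow> ('e \<Rightarrow> 'i \<Rightarrow> complex) \<Rightarrow> ('e \<Rightarrow> 'e \<Rightarrow> complex) \<Rightarrow> complex \<Rightarrow>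
     'i \<Rightarrow> 'i \<Rightarrow> complex" where
  "DtN_map H_I_II H_II_I H_II_II s g h =
     - (\<Sum>\<^sub>\<infinity>k. H_Gamma_II H_I_II g k *
              resolvent H_II_II (\<i> * s) (\<lambda>l. H_II_Gamma H_II_I l h) k)"

definition Et_M_E :: "'i set \<Rightarrow> ('i \<Rightarrow> 'i \<Rightarrow> complex) \<Rightarrow> complex^'i^'i::finite" where
  "Et_M_E \<Gamma> M = (\<chi> i j. \<Sum>g\<in>\<Gamma>. \<Sum>h\<in>\<Gamma>. restriction g i * M g h * restriction h j)"

text \<open>
  A possibly nonlinear interior Hamiltonian is a state-dependent matrix: its action is
  \<open>\<phi> \<mapsto> H_I_I \<phi> *v \<phi>\<close>, and the linear case is that of a constant \<open>H_I_I\<close>.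
\<close>

definition zeroth_order_rhs ::
  "(complex^'i \<Rightarrow> complex^'i^'i) \<Rightarrow> 'i set \<Rightarrow> ('i \<Rightarrow> 'i \<Rightarrow> complex) \<Rightarrow> complex^'i \<Rightarrow> complex^'i::finite" where
  "zeroth_order_rhs H_I_I \<Gamma> M \<phi> = - \<i> *s (H_I_I \<phi> *v \<phi>) - \<i> *s (Et_M_E \<Gamma> M *v \<phi>)"

definition is_solution :: "('a::real_normed_vector \<Rightarrow> 'a) \<Rightarrow> real \<Rightarrow> (real \<Rightarrow> 'a) \<Rightarrow> bool" where
  "is_solution f T x \<longleftrightarrow>
     (\<forall>t\<in>{0..<T}. (x has_vector_derivative f (x t)) (at t within {0..<T}))"

text \<open>
  The bound is demanded on every interval \<open>[0, T)\<close> on which a solution exists, with \<open>\<delta>\<close> independent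
  of \<open>T\<close>; this includes solutions on \<open>[0, \<infinity>)\<close>.
\<close>

definition lyapunov_stable_at_0 :: "('a::real_normed_vector \<Rightarrow> 'a) \<Rightarrow> bool" where
  "lyapunov_stable_at_0 f \<longleftrightarrow> f 0 = 0 \<and>
     (\<forall>\<epsilon>>0. \<exists>\<delta>>0. \<forall>T>0. \<forall>x. is_solution f T x \<and> norm (x 0) < \<delta> \<longrightarrow> (\<forall>t\<in>{0..<T}. norm (x t) < \<epsilon>))"

end

theory Submission
  imports Defs
begin

text \<open>
  Along a solution, \<open>\<parallel>\<phi>\<parallel>\<^sup>2\<close> has derivative \<open>2 Im \<langle>\<phi>, E\<^sup>T M E \<phi>\<rangle>\<close>, since the interior Hamiltonian is
  Hermitian at every state. With \<open>w = H_II_\<Gamma> v\<close> and \<open>(H_II_II - \<i> s) u = w\<close>,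
  \<open>\<langle>v, K(s) v\<rangle> = - \<langle>w, u\<rangle> = - \<langle>H_II_II u, u\<rangle> - \<i> s \<parallel>u\<parallel>\<^sup>2\<close>, whose imaginary part is \<open>- s \<parallel>u\<parallel>\<^sup>2 \<le> 0\<close>.
  Hence the norm never increases. Such a \<open>u\<close> exists in \<open>l2\<close> for \<open>s > 0\<close> because \<open>H_II_II\<close> is bounded
  and Hermitian. The resolvent is an \<open>inv_into\<close>, so only the surjectivity of the shifted operator matters.
\<close>

section \<open>Square-summable functions\<close>

lemma mult_le_sum_squares:
  fixes x y :: real
  shows "x * y \<le> x\<^sup>2 + y\<^sup>2"
proof -
  have "2 * (x * y) \<le> x\<^sup>2 + y\<^sup>2" using sum_squares_bound[of x y] by (simp only: mult.assoc)
  then show ?thesis using sum_power2_ge_zero[of x y] by linarith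
qed

lemma l2_iff: "u \<in> l2 \<longleftrightarrow> (\<lambda>k. (cmod (u k))\<^sup>2) summable_on UNIV"
  by (simp add: l2_def)

text \<open>Used to pass from estimates over finite sets to the whole grid, both for the operator
  bound and for the limit of the Neumann series.\<close>

lemma l2_bounded_sums:
  assumes "\<And>F. finite F \<Longrightarrow> (\<Sum>k\<in>F. (cmod (u k))\<^sup>2) \<le> B"
  shows "u \<in> l2" and "(\<Sum>\<^sub>\<infinity>k. (cmod (u k))\<^sup>2) \<le> B"
proof -
  show "u \<in> l2" unfolding l2_iff
    by (rule nonneg_bdd_above_summable_on) (auto intro!: bdd_aboveI2 assms)
  then show "(\<Sum>\<^sub>\<infinity>k. (cmod (u k))\<^sup>2) \<le> B"
    unfolding l2_iff by (rule infsum_le_finite_sums) (use assms in auto)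
qed

lemma l2_sum_le_infsum:
  assumes "u \<in> l2" "finite F"
  shows "(\<Sum>k\<in>F. (cmod (u k))\<^sup>2) \<le> (\<Sum>\<^sub>\<infinity>k. (cmod (u k))\<^sup>2)"
  using assms unfolding l2_iff by (intro finite_sum_le_infsum) auto

lemma l2_scale:
  assumes "u \<in> l2" shows "(\<lambda>k. c * u k) \<in> l2"
  using assms unfolding l2_iff
  by (auto simp: norm_mult power_mult_distrib intro: summable_on_cmult_right)

lemma l2_add:
  assumes "u \<in> l2" "v \<in> l2" shows "(\<lambda>k. u k + v k) \<in> l2"
proof -
  have "(\<lambda>k. norm ((cmod (u k + v k))\<^sup>2)) summable_on UNIV"
  proof (rule Infinite_Sum.abs_summable_on_comparison_test')
    show "(\<lambda>k. 2 * (cmod (u k))\<^sup>2 + 2 * (cmod (v k))\<^sup>2) summable_on UNIV"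
      using assms unfolding l2_iff by (intro summable_on_add summable_on_cmult_right)
    fix k
    have "(cmod (u k + v k))\<^sup>2 \<le> (cmod (u k) + cmod (v k))\<^sup>2"
      by (simp add: norm_triangle_ineq power_mono)
    also have "\<dots> \<le> 2 * (cmod (u k))\<^sup>2 + 2 * (cmod (v k))\<^sup>2"
      using sum_squares_bound[of "cmod (u k)" "cmod (v k)"] by (simp only: power2_sum)
    finally show "norm ((cmod (u k + v k))\<^sup>2) \<le> 2 * (cmod (u k))\<^sup>2 + 2 * (cmod (v k))\<^sup>2"
      by simp
  qed
  then show ?thesis by (simp add: l2_iff)
qed

lemma l2_sum:
  assumes "\<And>i. i \<in> I \<Longrightarrow> u i \<in> l2"
  shows "(\<lambda>k. \<Sum>i\<in>I. u i k) \<in> l2"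
  using assms
proof (induction I rule: infinite_finite_induct)
  case (insert i I)
  then show ?case using l2_add[of "u i" "\<lambda>k. \<Sum>i\<in>I. u i k"] by simp
qed (auto simp: l2_iff)

lemma l2_finite_support:
  assumes "finite {k. u k \<noteq> 0}" shows "u \<in> l2"
proof -
  have "(\<lambda>k. (cmod (u k))\<^sup>2) summable_on UNIV \<longleftrightarrow>
        (\<lambda>k. (cmod (u k))\<^sup>2) summable_on {k. u k \<noteq> 0}"
    by (rule summable_on_cong_neutral) auto
  then show ?thesis using assms by (simp add: l2_iff)
qed

lemma l2_inner_summable:
  assumes "u \<in> l2" "v \<in> l2" shows "(\<lambda>k. cnj (u k) * v k) summable_on UNIV"
proof -
  have "(\<lambda>k. norm (cnj (u k) * v k)) summable_on UNIV"
  proof (rule Infinite_Sum.abs_summable_on_comparison_test')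
    show "(\<lambda>k. (cmod (u k))\<^sup>2 + (cmod (v k))\<^sup>2) summable_on UNIV"
      using assms unfolding l2_iff by (rule summable_on_add)
    show "norm (cnj (u k) * v k) \<le> (cmod (u k))\<^sup>2 + (cmod (v k))\<^sup>2" for k
      by (simp add: norm_mult mult_le_sum_squares)
  qed
  then show ?thesis by (rule abs_summable_summable)
qed

section \<open>Hermitian operators with finite stencils\<close>

text \<open>The witnesses of \<open>finite_difference_matrix\<close> become parameters.
  \<open>N\<close> and \<open>C\<close> are common to all rows; this uniformity is what bounds the
  operator on \<open>l2\<close>.\<close>

locale hermitian_stencil =
  fixes A :: "'e \<Rightarrow> 'e \<Rightarrow> complex" and N :: nat and C :: real
  assumes hermitian: "hermitian_matrix A"
    and finite_row: "finite {l. A k l \<noteq> 0}"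
    and card_row: "card {l. A k l \<noteq> 0} \<le> N"
    and entry_bound: "cmod (A k l) \<le> C"
begin

text \<open>As a finite sum over the stencil, the action is linear and compatible with pointwise
  limits for every \<open>u\<close>, in \<open>l2\<close> or not.\<close>

definition app :: "('e \<Rightarrow> complex) \<Rightarrow> 'e \<Rightarrow> complex" where
  "app u k = (\<Sum>l | A k l \<noteq> 0. A k l * u l)"

lemma infsum_row: "(\<Sum>\<^sub>\<infinity>l. A k l * u l) = app u k"
proof -
  have "(\<Sum>\<^sub>\<infinity>l. A k l * u l) = (\<Sum>\<^sub>\<infinity>l\<in>{l. A k l \<noteq> 0}. A k l * u l)"
    by (rule infsum_cong_neutral) auto
  then show ?thesis using finite_row by (simp add: app_def)
qed

lemma shifted_op_eq: "shifted_op A z u k = app u k - z * u k"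
  by (simp add: shifted_op_def infsum_row)

lemma app_scale: "app (\<lambda>k. c * u k) k = c * app u k"
  by (simp add: app_def sum_distrib_left mult_ac)

lemma app_sum: "app (\<lambda>k. \<Sum>i\<in>I. u i k) k = (\<Sum>i\<in>I. app (u i) k)"
  unfolding app_def sum_distrib_left by (rule sum.swap)

lemma column_eq: "{k. A k l \<noteq> 0} = {k. A l k \<noteq> 0}"
  using hermitian unfolding hermitian_matrix_def
  by (metis complex_cnj_zero_iff)

lemma C_nonneg: "0 \<le> C"
  using entry_bound[of undefined undefined] norm_ge_zero order_trans by blast

text \<open>Cauchy-Schwarz against the constant 1 on a single row gives the factor \<open>N\<close>,
  which bounds the size of its support.\<close>

lemma cmod_app_sq:
  "(cmod (app u k))\<^sup>2 \<le> N * C\<^sup>2 * (\<Sum>l | A k l \<noteq> 0. (cmod (u l))\<^sup>2)"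
proof -
  let ?S = "{l. A k l \<noteq> 0}"
  have "(cmod (app u k))\<^sup>2 \<le> (\<Sum>l\<in>?S. C * cmod (u l))\<^sup>2"
    unfolding app_def
    by (intro power_mono norm_ge_zero order_trans[OF norm_sum] sum_mono)
       (auto simp: norm_mult intro!: mult_right_mono entry_bound)
  also have "\<dots> = C\<^sup>2 * (\<Sum>l\<in>?S. cmod (u l))\<^sup>2"
    by (simp add: sum_distrib_left[symmetric] power_mult_distrib)
  also have "\<dots> \<le> C\<^sup>2 * (N * (\<Sum>l\<in>?S. (cmod (u l))\<^sup>2))"
  proof (rule mult_left_mono)
    have "(\<Sum>l\<in>?S. cmod (u l))\<^sup>2 \<le> card ?S * (\<Sum>l\<in>?S. (cmod (u l))\<^sup>2)"
    using Cauchy_Schwarz_ineq_sum[of "\<lambda>_. 1" "\<lambda>l. cmod (u l)" ?S] by simp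
    also have "\<dots> \<le> N * (\<Sum>l\<in>?S. (cmod (u l))\<^sup>2)"
      by (intro mult_right_mono sum_nonneg) (use card_row in auto)
    finally show "(\<Sum>l\<in>?S. cmod (u l))\<^sup>2 \<le> N * (\<Sum>l\<in>?S. (cmod (u l))\<^sup>2)" .
  qed simp
  finally show ?thesis by (simp add: mult_ac)
qed

text \<open>Columns have at most \<open>N\<close> nonzero entries as well, so each \<open>l\<close> is counted at most \<open>N\<close> times.\<close>
lemma sum_rows_le:
  fixes g :: "'e \<Rightarrow> real" and B :: real
  assumes "finite F" "\<And>l. g l \<ge> 0" "\<And>G. finite G \<Longrightarrow> sum g G \<le> B"
  shows "(\<Sum>k\<in>F. \<Sum>l | A k l \<noteq> 0. g l) \<le> N * B"
proof -
  \<comment> \<open>Only finitely many columns meet the rows in \<open>F\<close>, so the exchange of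
    summations stays within finite sets.\<close>
  let ?G = "\<Union>k\<in>F. {l. A k l \<noteq> 0}"
  have fin: "finite ?G" using assms(1) finite_row by auto
  have "(\<Sum>k\<in>F. \<Sum>l | A k l \<noteq> 0. g l) = (\<Sum>k\<in>F. \<Sum>l | l \<in> ?G \<and> A k l \<noteq> 0. g l)"
    by (rule sum.cong) (auto intro!: sum.cong)
  also have "\<dots> = (\<Sum>l\<in>?G. \<Sum>k | k \<in> F \<and> A k l \<noteq> 0. g l)"
    by (rule sum.swap_restrict[OF assms(1) fin])
  also have "\<dots> \<le> (\<Sum>l\<in>?G. N * g l)"
  proof (rule sum_mono)
    fix l
    have "card {k. k \<in> F \<and> A k l \<noteq> 0} \<le> card {k. A l k \<noteq> 0}"
      using column_eq by (intro card_mono finite_row) blast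
    also have "\<dots> \<le> N" by (rule card_row)
    finally show "(\<Sum>k | k \<in> F \<and> A k l \<noteq> 0. g l) \<le> N * g l"
      using assms(2) by (simp add: mult_right_mono)
  qed
  also have "\<dots> = N * sum g ?G" by (simp add: sum_distrib_left)
  also have "\<dots> \<le> N * B" by (intro mult_left_mono assms(3) fin) auto
  finally show ?thesis .
qed

text \<open>One factor \<open>N\<close> comes from Cauchy-Schwarz along a row, the other from the
  overlap of the stencils. The operator norm is thus at most \<open>N * C\<close>.\<close>

lemma app_l2_bound:
  assumes "u \<in> l2"
  shows "app u \<in> l2"
    and "(\<Sum>\<^sub>\<infinity>k. (cmod (app u k))\<^sup>2) \<le> N\<^sup>2 * C\<^sup>2 * (\<Sum>\<^sub>\<infinity>k. (cmod (u k))\<^sup>2)"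
proof -
  let ?B = "\<Sum>\<^sub>\<infinity>k. (cmod (u k))\<^sup>2"
  have "(\<Sum>k\<in>F. (cmod (app u k))\<^sup>2) \<le> N\<^sup>2 * C\<^sup>2 * ?B" if "finite F" for F
  proof -
    have "(\<Sum>k\<in>F. (cmod (app u k))\<^sup>2)
        \<le> (\<Sum>k\<in>F. N * C\<^sup>2 * (\<Sum>l | A k l \<noteq> 0. (cmod (u l))\<^sup>2))"
      by (intro sum_mono cmod_app_sq)
    also have "\<dots> = N * C\<^sup>2 * (\<Sum>k\<in>F. \<Sum>l | A k l \<noteq> 0. (cmod (u l))\<^sup>2)"
      by (simp add: sum_distrib_left)
    also have "\<dots> \<le> N * C\<^sup>2 * (N * ?B)"
      by (intro mult_left_mono sum_rows_le that l2_sum_le_infsum assms) auto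
    finally show ?thesis by (simp add: power2_eq_square mult_ac)
  qed
  note bound = this
  show "app u \<in> l2" using bound by (rule l2_bounded_sums(1))
  show "(\<Sum>\<^sub>\<infinity>k. (cmod (app u k))\<^sup>2) \<le> N\<^sup>2 * C\<^sup>2 * ?B"
    using bound by (rule l2_bounded_sums(2))
qed

text \<open>Half of the majorant for the double series of the quadratic form. Row \<open>k\<close>
  contributes the square of \<open>cmod (u k)\<close> at most \<open>N\<close> times, so the rows
  add up to at most \<open>N\<close> times the squared norm.\<close>

lemma summable_on_stencil:
  assumes "u \<in> l2"
  shows "(\<lambda>(k, l). if A k l \<noteq> 0 then (cmod (u k))\<^sup>2 else 0) summable_on UNIV \<times> UNIV"
proof -
  have inner: "(\<Sum>\<^sub>\<infinity>l. if A k l \<noteq> 0 then (cmod (u k))\<^sup>2 else 0) = card {l. A k l \<noteq> 0} * (cmod (u k))\<^sup>2" for k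
  proof -
    have "(\<Sum>\<^sub>\<infinity>l. if A k l \<noteq> 0 then (cmod (u k))\<^sup>2 else 0) = (\<Sum>\<^sub>\<infinity>l\<in>{l. A k l \<noteq> 0}. (cmod (u k))\<^sup>2)"
      by (rule infsum_cong_neutral) auto
    then show ?thesis using finite_row by simp
  qed
  have row: "(\<lambda>l. if A k l \<noteq> 0 then (cmod (u k))\<^sup>2 else 0) summable_on UNIV" for k
  proof -
    have "(\<lambda>l. if A k l \<noteq> 0 then (cmod (u k))\<^sup>2 else 0) summable_on UNIV \<longleftrightarrow>
      (\<lambda>l. (cmod (u k))\<^sup>2) summable_on {l. A k l \<noteq> 0}"
      by (rule summable_on_cong_neutral) auto
    then show ?thesis using finite_row by simp
  qed
  have "(\<lambda>k. norm (card {l. A k l \<noteq> 0} * (cmod (u k))\<^sup>2)) summable_on UNIV"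
  proof (rule Infinite_Sum.abs_summable_on_comparison_test')
    show "(\<lambda>k. N * (cmod (u k))\<^sup>2) summable_on UNIV"
      using assms unfolding l2_iff by (rule summable_on_cmult_right)
  qed (use card_row in \<open>auto intro!: mult_right_mono\<close>)
  then have "(\<lambda>p. norm (case p of (k, l) \<Rightarrow> if A k l \<noteq> 0 then (cmod (u k))\<^sup>2 else 0)) summable_on UNIV \<times> UNIV"
    unfolding Infinite_Sum.abs_summable_on_Sigma_iff using row
    by (simp add: inner if_distrib[of abs] cong: if_cong)
  then show ?thesis by (rule abs_summable_summable)
qed

text \<open>The double series converges absolutely, so its summations may be exchanged; by Hermitian
  symmetry the exchange turns the sum into its own conjugate.\<close>

lemma quadratic_form_real:
  assumes "u \<in> l2"
  shows "Im (\<Sum>\<^sub>\<infinity>k. cnj (u k) * app u k) = 0"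
proof -
  define g where "g k l = cnj (u k) * A k l * u l" for k l
  have "(\<lambda>p. norm (case p of (k, l) \<Rightarrow> g k l)) summable_on UNIV \<times> UNIV"
  proof (rule Infinite_Sum.abs_summable_on_comparison_test')
    let ?h = "\<lambda>(k, l). if A k l \<noteq> 0 then (cmod (u k))\<^sup>2 else 0"
    have 1: "?h summable_on UNIV \<times> UNIV" by (rule summable_on_stencil[OF assms])
    \<comment> \<open>The product of \<open>cmod (u k)\<close> and \<open>cmod (u l)\<close> is
      bounded by the sum of the squares. The square at \<open>l\<close> needs the majorant with its
      arguments exchanged, which lives on the same pairs because the sparsity pattern is
      symmetric.\<close>
    then have 2: "(\<lambda>(k, l). ?h (l, k)) summable_on UNIV \<times> UNIV"
      by (subst (asm) summable_on_swap)
    show "(\<lambda>p. C * (?h p + (case p of (k, l) \<Rightarrow> ?h (l, k)))) summable_on UNIV \<times> UNIV"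
      by (intro summable_on_cmult_right summable_on_add 1 2)
    fix p :: "'e \<times> 'e"
    obtain k l where p: "p = (k, l)" by (cases p)
    have swap: "A l k \<noteq> 0 \<longleftrightarrow> A k l \<noteq> 0" using column_eq[of k] by blast
    have "cmod (u k) * cmod (u l) \<le> (cmod (u k))\<^sup>2 + (cmod (u l))\<^sup>2"
      by (rule mult_le_sum_squares)
    then have "cmod (A k l) * (cmod (u k) * cmod (u l)) \<le> C * ((cmod (u k))\<^sup>2 + (cmod (u l))\<^sup>2)"
      by (intro mult_mono entry_bound C_nonneg) auto
    then show "norm (case p of (k, l) \<Rightarrow> g k l) \<le> C * (?h p + (case p of (k, l) \<Rightarrow> ?h (l, k)))"
      using swap by (cases "A k l = 0") (auto simp: p g_def norm_mult mult_ac)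
  qed
  then have sm: "(\<lambda>(k, l). g k l) summable_on UNIV \<times> UNIV"
    by (rule abs_summable_summable)
  have row: "(\<Sum>\<^sub>\<infinity>l. g k l) = cnj (u k) * app u k" for k
  proof -
    have "(\<Sum>\<^sub>\<infinity>l. g k l) = (\<Sum>\<^sub>\<infinity>l. cnj (u k) * (A k l * u l))"
      by (simp add: g_def mult_ac)
    also have "\<dots> = cnj (u k) * (\<Sum>\<^sub>\<infinity>l. A k l * u l)" by (rule infsum_cmult_right')
    finally show ?thesis by (simp add: infsum_row)
  qed
  have sym: "g k l = cnj (g l k)" for k l
  proof -
    have "A k l = cnj (A l k)" using hermitian unfolding hermitian_matrix_def by blast
    then show ?thesis by (simp add: g_def)
  qed
  have "(\<Sum>\<^sub>\<infinity>k. \<Sum>\<^sub>\<infinity>l. g k l) = (\<Sum>\<^sub>\<infinity>l. \<Sum>\<^sub>\<infinity>k. g k l)"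
    using sm by (rule infsum_swap_banach)
  also have "\<dots> = (\<Sum>\<^sub>\<infinity>l. \<Sum>\<^sub>\<infinity>k. cnj (g l k))" by (subst sym) (rule refl)
  also have "\<dots> = cnj (\<Sum>\<^sub>\<infinity>l. \<Sum>\<^sub>\<infinity>k. g l k)" by simp
  finally have "(\<Sum>\<^sub>\<infinity>k. cnj (u k) * app u k) = cnj (\<Sum>\<^sub>\<infinity>k. cnj (u k) * app u k)"
    by (simp add: row)
  then show ?thesis by (metis cnj.sel(2) neg_equal_zero)
qed

text \<open>The cross term of the square vanishes after summation because the quadratic form is real.\<close>
lemma norm_real_plus_imaginary_multiple:
  fixes a b :: real and u :: "'e \<Rightarrow> complex"
  assumes "u \<in> l2"
  defines "v \<equiv> \<lambda>k. a * u k - \<i> * b * app u k"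
  shows "v \<in> l2"
    and "(\<Sum>\<^sub>\<infinity>k. (cmod (v k))\<^sup>2) \<le> (a\<^sup>2 + b\<^sup>2 * (N\<^sup>2 * C\<^sup>2)) * (\<Sum>\<^sub>\<infinity>k. (cmod (u k))\<^sup>2)"
proof -
  show "v \<in> l2"
    using l2_add[OF l2_scale[OF assms(1), of a] l2_scale[OF app_l2_bound(1)[OF assms(1)], of "- \<i> * b"]]
    by (simp add: v_def)
  have pt: "(cmod (v k))\<^sup>2 = a\<^sup>2 * (cmod (u k))\<^sup>2 + b\<^sup>2 * (cmod (app u k))\<^sup>2
      + 2 * a * b * Im (cnj (u k) * app u k)" for k
    unfolding v_def cmod_power2 by (simp add: power2_eq_square algebra_simps)
  have s: "(\<lambda>k. cnj (u k) * app u k) summable_on UNIV"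
    by (intro l2_inner_summable app_l2_bound assms)
  have s1: "(\<lambda>k. (cmod (u k))\<^sup>2) summable_on UNIV" using assms(1) l2_iff by blast
  have s2: "(\<lambda>k. (cmod (app u k))\<^sup>2) summable_on UNIV"
    using app_l2_bound(1)[OF assms(1)] l2_iff by blast
  have "(\<Sum>\<^sub>\<infinity>k. (cmod (v k))\<^sup>2) = a\<^sup>2 * (\<Sum>\<^sub>\<infinity>k. (cmod (u k))\<^sup>2) + b\<^sup>2 * (\<Sum>\<^sub>\<infinity>k. (cmod (app u k))\<^sup>2)
     + 2 * a * b * (\<Sum>\<^sub>\<infinity>k. Im (cnj (u k) * app u k))"
    unfolding pt
    by (simp only: infsum_add infsum_cmult_right' summable_on_add summable_on_cmult_right
          s1 s2 summable_on_Im[OF s])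
  also have "(\<Sum>\<^sub>\<infinity>k. Im (cnj (u k) * app u k)) = 0"
    using infsum_Im[OF s] quadratic_form_real[OF assms(1)] by simp
  also have "b\<^sup>2 * (\<Sum>\<^sub>\<infinity>k. (cmod (app u k))\<^sup>2) \<le> b\<^sup>2 * (N\<^sup>2 * C\<^sup>2 * (\<Sum>\<^sub>\<infinity>k. (cmod (u k))\<^sup>2))"
    by (intro mult_left_mono app_l2_bound assms) auto
  finally show "(\<Sum>\<^sub>\<infinity>k. (cmod (v k))\<^sup>2) \<le> (a\<^sup>2 + b\<^sup>2 * (N\<^sup>2 * C\<^sup>2)) * (\<Sum>\<^sub>\<infinity>k. (cmod (u k))\<^sup>2)"
    by (simp add: algebra_simps)
qed

text \<open>
  Neumann series of the contraction \<open>1 - \<rho> (s + \<i> A)\<close>. The terms decay geometrically in \<open>l2\<close>, hence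
  pointwise; as the rows of \<open>A\<close> are finite, the pointwise limit already solves the equation, and it
  lies in \<open>l2\<close> because its finite partial square sums are bounded.
\<close>
lemma shifted_op_imaginary_surj:
  fixes s :: real
  assumes "s > 0" "w \<in> l2"
  shows "w \<in> shifted_op A (\<i> * s) ` l2"
proof -
  define L where "L = N\<^sup>2 * C\<^sup>2"
  have L: "L \<ge> 0" by (simp add: L_def)
  have sL: "s\<^sup>2 + L > 0" using assms(1) L by (simp add: add_pos_nonneg)
  \<comment> \<open>This is the \<rho> of the contraction. It minimizes
    \<open>(1 - r * s)\<^sup>2 + r\<^sup>2 * L\<close>, and the minimum
    \<open>L / (s\<^sup>2 + L)\<close> is below 1 because \<open>s > 0\<close>.\<close>
  define r where "r = s / (s\<^sup>2 + L)"
  have r: "r > 0" using sL assms(1) by (simp add: r_def)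
  define a where "a = 1 - r * s"
  define q2 where "q2 = a\<^sup>2 + r\<^sup>2 * L"
  have q2: "q2 = L / (s\<^sup>2 + L)"
  proof -
    have e: "r * (s\<^sup>2 + L) = s" using sL by (simp add: r_def)
    have "q2 = 1 - 2 * (r * s) + r * (r * (s\<^sup>2 + L))"
      by (simp add: q2_def a_def power2_eq_square algebra_simps)
    also have "\<dots> = 1 - r * s" by (simp add: e)
    also have "\<dots> = L / (s\<^sup>2 + L)" using sL by (simp add: r_def field_simps power2_eq_square)
    finally show ?thesis .
  qed
  define q where "q = sqrt q2"
  have "0 \<le> q2" "q2 < 1" using sL L assms(1) by (simp_all add: q2)
  then have q: "0 \<le> q" "q < 1" "q\<^sup>2 = q2" by (simp_all add: q_def)
  \<comment> \<open>Multiplying \<open>(A - \<i> s) u = w\<close> by \<open>\<i> r\<close> gives the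
    fixed point equation \<open>u = T u + \<i> r w\<close>; hence the series starts at
    \<open>\<i> r w\<close> and is generated by powers of \<open>T\<close>.\<close>
  define T where "T = (\<lambda>(u :: 'e \<Rightarrow> complex) k. a * u k - \<i> * r * app u k)"
  define d where "d n = (T ^^ n) (\<lambda>k. \<i> * r * w k)" for n
  have d0: "d 0 = (\<lambda>k. \<i> * r * w k)" by (simp add: d_def)
  have dSuc: "d (Suc n) k = a * d n k - \<i> * r * app (d n) k" for n k
    by (simp add: d_def T_def)
  define D where "D = sqrt (\<Sum>\<^sub>\<infinity>k. (cmod (d 0 k))\<^sup>2)"
  have D: "D \<ge> 0" "D\<^sup>2 = (\<Sum>\<^sub>\<infinity>k. (cmod (d 0 k))\<^sup>2)"
    unfolding D_def by (auto intro!: infsum_nonneg)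
  have dn: "d n \<in> l2 \<and> (\<Sum>\<^sub>\<infinity>k. (cmod (d n k))\<^sup>2) \<le> (q ^ n * D)\<^sup>2" for n
  proof (induction n)
    case 0
    then show ?case using assms(2) D by (simp add: d0 l2_scale)
  next
    case (Suc n)
    have eq: "d (Suc n) = (\<lambda>k. a * d n k - \<i> * r * app (d n) k)" using dSuc by blast
    have "(\<Sum>\<^sub>\<infinity>k. (cmod (d (Suc n) k))\<^sup>2) \<le> q\<^sup>2 * (\<Sum>\<^sub>\<infinity>k. (cmod (d n k))\<^sup>2)"
      using norm_real_plus_imaginary_multiple(2)[of "d n" a r] Suc
      unfolding eq q(3) q2_def L_def by simp
    also have "\<dots> \<le> q\<^sup>2 * (q ^ n * D)\<^sup>2" using Suc by (intro mult_left_mono) auto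
    finally show ?case
      using norm_real_plus_imaginary_multiple(1)[of "d n" a r] Suc
      by (simp add: eq power_mult_distrib mult_ac)
  qed
  \<comment> \<open>Finite sections are measured by \<open>L2_set\<close> for the sake of its
    triangle inequality; the section \<open>{k}\<close> gives the pointwise geometric decay.\<close>
  have dF: "L2_set (\<lambda>k. cmod (d n k)) F \<le> q ^ n * D" if "finite F" for F n
  proof -
    have "(\<Sum>k\<in>F. (cmod (d n k))\<^sup>2) \<le> (q ^ n * D)\<^sup>2"
      using l2_sum_le_infsum[OF _ that, of "d n"] dn[of n] by linarith
    then show ?thesis
      unfolding L2_set_def using q D by (intro real_le_lsqrt) (auto intro!: sum_nonneg)
  qed
  have qs: "summable (\<lambda>n. q ^ n * D)" using q by (intro summable_mult2 summable_geometric) auto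
  have dsm: "summable (\<lambda>n. d n k)" for k
    by (rule summable_comparison_test'[OF qs, of 0]) (use dF[of "{k}"] in \<open>simp add: L2_set_def\<close>)
  define u where "u k = (\<Sum>n. d n k)" for k
  define p where "p n k = (\<Sum>j<n. d j k)" for n k
  have lim: "(\<lambda>n. p n k) \<longlonglongrightarrow> u k" for k
    unfolding u_def p_def using dsm by (rule summable_LIMSEQ)
  \<comment> \<open>The bound is uniform in \<open>n\<close> and \<open>F\<close>, so it survives
    the pointwise limit and puts \<open>u\<close> into \<open>l2\<close>.\<close>
  have pF: "L2_set (\<lambda>k. cmod (p n k)) F \<le> D / (1 - q)" if "finite F" for F n
  proof -
    have "L2_set (\<lambda>k. cmod (p n k)) F \<le> (\<Sum>j<n. q ^ j * D)"
    proof (induction n)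
      case 0
      then show ?case by (simp add: p_def L2_set_def)
    next
      case (Suc n)
      have "L2_set (\<lambda>k. cmod (p (Suc n) k)) F \<le> L2_set (\<lambda>k. cmod (p n k) + cmod (d n k)) F"
        by (rule L2_set_mono) (auto simp: p_def norm_triangle_ineq)
      also have "\<dots> \<le> L2_set (\<lambda>k. cmod (p n k)) F + L2_set (\<lambda>k. cmod (d n k)) F"
        by (rule L2_set_triangle_ineq)
      finally show ?case using Suc dF[OF that, of n] by simp
    qed
    also have "\<dots> \<le> (\<Sum>j. q ^ j * D)"
      using q D by (intro sum_le_suminf qs) auto
    also have "\<dots> = D / (1 - q)"
      using q suminf_mult2[of "\<lambda>n. q ^ n" D] by (simp add: suminf_geometric summable_geometric)
    finally show ?thesis .
  qed
  have "(\<Sum>k\<in>F. (cmod (u k))\<^sup>2) \<le> (D / (1 - q))\<^sup>2" if "finite F" for F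
  proof (rule LIMSEQ_le_const2)
    show "(\<lambda>n. \<Sum>k\<in>F. (cmod (p n k))\<^sup>2) \<longlonglongrightarrow> (\<Sum>k\<in>F. (cmod (u k))\<^sup>2)"
      by (intro tendsto_intros lim)
    show "\<exists>M. \<forall>n\<ge>M. (\<Sum>k\<in>F. (cmod (p n k))\<^sup>2) \<le> (D / (1 - q))\<^sup>2"
    proof (intro exI allI impI)
      fix n
      show "(\<Sum>k\<in>F. (cmod (p n k))\<^sup>2) \<le> (D / (1 - q))\<^sup>2"
        using pF[OF that, of n] unfolding L2_set_def by (rule sqrt_le_D)
    qed
  qed
  then have ul2: "u \<in> l2" by (rule l2_bounded_sums(1))
  have "shifted_op A (\<i> * s) u k = w k" for k
  proof -
    \<comment> \<open>The partial sums satisfy \<open>p (Suc n) = d 0 + T (p n)\<close>; the limit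
      of both sides at \<open>k\<close> is the fixed point equation.\<close>
    have step: "p (Suc n) k = d 0 k + (a * p n k - \<i> * r * app (p n) k)" for n
    proof -
      have "p (Suc n) k = d 0 k + (\<Sum>j<n. d (Suc j) k)"
        unfolding p_def by (simp only: sum.lessThan_Suc_shift)
      also have "(\<Sum>j<n. d (Suc j) k) = a * p n k - \<i> * r * app (p n) k"
        unfolding p_def app_sum by (simp add: dSuc sum_subtractf sum_distrib_left)
      finally show ?thesis .
    qed
    have "(\<lambda>n. d 0 k + (a * p n k - \<i> * r * app (p n) k))
        \<longlonglongrightarrow> d 0 k + (a * u k - \<i> * r * app u k)"
      unfolding app_def by (intro tendsto_intros lim)
    moreover have "(\<lambda>n. d 0 k + (a * p n k - \<i> * r * app (p n) k)) \<longlonglongrightarrow> u k"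
      using lim[of k] unfolding step[symmetric] by (rule LIMSEQ_Suc)
    ultimately have "u k = \<i> * r * w k + (a * u k - \<i> * r * app u k)"
      unfolding d0 by (rule LIMSEQ_unique[rotated])
    then have "\<i> * r * (app u k - \<i> * s * u k - w k) = 0"
      by (simp add: a_def algebra_simps)
    then show ?thesis using r by (simp add: shifted_op_eq)
  qed
  then have "shifted_op A (\<i> * s) u = w" by blast
  then show ?thesis using ul2 by blast
qed

text \<open>The conjugate on the first factor turns \<open>- \<i> s\<close> into
  \<open>\<i> s\<close>. As the form of \<open>A\<close> is real, the imaginary part is exactly
  \<open>s\<close> times the squared norm of \<open>u\<close>.\<close>

lemma Im_inner_shifted_op_nonneg:
  fixes s :: real
  assumes "u \<in> l2" "s \<ge> 0"
  shows "Im (\<Sum>\<^sub>\<infinity>k. cnj (shifted_op A (\<i> * s) u k) * u k) \<ge> 0"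
proof -
  have s1: "(\<lambda>k. cnj (app u k) * u k) summable_on UNIV"
    by (intro l2_inner_summable app_l2_bound assms)
  have s2: "(\<lambda>k. cnj (u k) * u k) summable_on UNIV"
    by (intro l2_inner_summable assms)
  have "(\<Sum>\<^sub>\<infinity>k. cnj (shifted_op A (\<i> * s) u k) * u k)
      = (\<Sum>\<^sub>\<infinity>k. cnj (app u k) * u k + \<i> * s * (cnj (u k) * u k))"
    by (simp add: shifted_op_eq algebra_simps)
  also have "\<dots> = (\<Sum>\<^sub>\<infinity>k. cnj (app u k) * u k) + \<i> * s * (\<Sum>\<^sub>\<infinity>k. cnj (u k) * u k)"
    by (simp only: infsum_add s1 s2 summable_on_cmult_right infsum_cmult_right')
  also have "(\<Sum>\<^sub>\<infinity>k. cnj (app u k) * u k) = cnj (\<Sum>\<^sub>\<infinity>k. cnj (u k) * app u k)"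
    by (simp flip: infsum_cnj add: mult.commute)
  finally have "Im (\<Sum>\<^sub>\<infinity>k. cnj (shifted_op A (\<i> * s) u k) * u k)
      = s * Re (\<Sum>\<^sub>\<infinity>k. cnj (u k) * u k)"
    using quadratic_form_real[OF assms(1)] by simp
  moreover have "Re (\<Sum>\<^sub>\<infinity>k. cnj (u k) * u k) \<ge> 0"
    using infsum_Re[OF s2, symmetric] by (simp add: infsum_nonneg)
  ultimately show ?thesis using assms(2) by simp
qed

end

section \<open>Dissipativity of the Dirichlet-to-Neumann map\<close>

lemma exterior_hermitian_stencil:
  assumes "hermitian_matrix (block_matrix P Q R D)" "finite_difference_matrix (block_matrix P Q R D)"
  shows "\<exists>N C. hermitian_stencil D N C"
proof -
  let ?H = "block_matrix P Q R D"
  obtain N C where NC: "\<And>j. finite {k. ?H j k \<noteq> 0}" "\<And>j. card {k. ?H j k \<noteq> 0} \<le> N"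
    "\<And>j k. cmod (?H j k) \<le> C"
    using assms(2) unfolding finite_difference_matrix_def by blast
  have sub: "Inr ` {l. D k l \<noteq> 0} \<subseteq> {l. ?H (Inr k) l \<noteq> 0}" for k by auto
  have "hermitian_stencil D N C"
  proof
    show "hermitian_matrix D"
      unfolding hermitian_matrix_def
    proof (intro allI)
      show "D j k = cnj (D k j)" for j k
        using assms(1)[unfolded hermitian_matrix_def, rule_format, of "Inr j" "Inr k"] by simp
    qed
    show "finite {l. D k l \<noteq> 0}" for k
      using finite_subset[OF sub NC(1)] by (rule finite_imageD) simp
    show "card {l. D k l \<noteq> 0} \<le> N" for k
      using card_mono[OF NC(1) sub, of k] NC(2)[of "Inr k"] by (simp add: card_image)
    show "cmod (D k l) \<le> C" for k l using NC(3)[of "Inr k" "Inr l"] by simp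
  qed
  then show ?thesis by blast
qed

text \<open>Together with Hermitian symmetry this makes the right-hand sides of the resolvent
  equations finitely supported, and the sum in \<open>DtN_map\<close> finite.\<close>

lemma coupling_finite_row:
  fixes Q :: "'a \<Rightarrow> 'b \<Rightarrow> complex"
  assumes "finite_difference_matrix (block_matrix P Q R D)"
  shows "finite {k. Q g k \<noteq> 0}"
proof -
  have "finite {k. block_matrix P Q R D (Inl g) k \<noteq> 0}"
    using assms unfolding finite_difference_matrix_def by blast
  moreover have "Inr ` {k. Q g k \<noteq> 0} \<subseteq> {k. block_matrix P Q R D (Inl g) k \<noteq> 0}" by auto
  ultimately have "finite (Inr ` {k. Q g k \<noteq> 0} :: ('a + 'b) set)" by (rule finite_subset[rotated])
  then show ?thesis by (rule finite_imageD) simp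
qed

text \<open>By linearity the resolvent solutions for single boundary points combine into one
  \<open>u\<close> whose image under the shifted operator is \<open>R v\<close>; the form of
  \<open>DtN_map\<close> at \<open>v\<close> is minus the inner product of that image with
  \<open>u\<close>.\<close>

lemma Im_DtN_form_nonpos:
  fixes Q :: "'i::finite \<Rightarrow> 'e \<Rightarrow> complex" and s :: real
  assumes herm: "hermitian_matrix (block_matrix P Q R D)"
    and fd: "finite_difference_matrix (block_matrix P Q R D)"
    and "0 \<le> s" and inv: "s = 0 \<longrightarrow> shifted_op_invertible D 0"
  shows "Im (\<Sum>g\<in>\<Gamma>. \<Sum>h\<in>\<Gamma>. cnj (v g) * DtN_map Q R D (of_real s) g h * v h) \<le> 0"
proof -
  obtain N C where "hermitian_stencil D N C"
    using exterior_hermitian_stencil[OF herm fd] by blast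
  then interpret hermitian_stencil D N C .
  have QR: "R k g = cnj (Q g k)" for k g
    using herm[unfolded hermitian_matrix_def, rule_format, of "Inr k" "Inl g"] by simp
  have HG: "H_Gamma_II Q g k = Q g k" for g k
    unfolding H_Gamma_II_def restriction_def by (simp add: mult_delta_left mult_delta_right)
  have GH: "H_II_Gamma R k g = R k g" for g k
    unfolding H_II_Gamma_def restriction_def by (simp add: mult_delta_left mult_delta_right)
  have fin: "finite {k. Q g k \<noteq> 0}" for g by (rule coupling_finite_row[OF fd])
  define w where "w h = (\<lambda>l. R l h)" for h
  have w: "w h \<in> l2" for h
    by (rule l2_finite_support) (use fin[of h] in \<open>simp add: w_def QR\<close>)
  \<comment> \<open>For \<open>s = 0\<close> solvability comes from \<open>inv\<close>, for
    \<open>s > 0\<close> from the Neumann series.\<close>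
  have surj: "w h \<in> shifted_op D (\<i> * s) ` l2" for h
  proof (cases "s = 0")
    case True
    then show ?thesis using inv w unfolding shifted_op_invertible_def bij_betw_def by auto
  next
    case False
    then show ?thesis using assms(3) shifted_op_imaginary_surj[OF _ w] by auto
  qed
  define r where "r h = resolvent D (\<i> * s) (w h)" for h
  have r: "r h \<in> l2" "shifted_op D (\<i> * s) (r h) = w h" for h
    unfolding r_def resolvent_def by (rule inv_into_into[OF surj], rule f_inv_into_f[OF surj])
  define u where "u k = (\<Sum>h\<in>\<Gamma>. v h * r h k)" for k
  have u: "u \<in> l2" unfolding u_def by (intro l2_sum l2_scale r)
  have Tu: "shifted_op D (\<i> * s) u k = (\<Sum>h\<in>\<Gamma>. v h * R k h)" for k
  proof -
    have "shifted_op D (\<i> * s) u k = (\<Sum>h\<in>\<Gamma>. v h * shifted_op D (\<i> * s) (r h) k)"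
      unfolding shifted_op_eq u_def app_sum app_scale
      by (simp add: sum_subtractf sum_distrib_left algebra_simps)
    then show ?thesis by (simp add: r w_def)
  qed
  \<comment> \<open>Exterior points coupled to the interior: off this finite set both
    \<open>Q\<close> and the image of \<open>u\<close> vanish, so all sums become finite and can be
    reordered.\<close>
  define S where "S = (\<Union>g\<in>UNIV. {k. Q g k \<noteq> 0})"
  have S: "finite S" "\<And>g k. k \<notin> S \<Longrightarrow> Q g k = 0" using fin by (auto simp: S_def)
  have K: "DtN_map Q R D (of_real s) g h = - (\<Sum>k\<in>S. Q g k * r h k)" for g h
  proof -
    have "DtN_map Q R D (of_real s) g h = - (\<Sum>\<^sub>\<infinity>k. Q g k * r h k)"
      by (simp add: DtN_map_def HG GH r_def w_def)
    also have "(\<Sum>\<^sub>\<infinity>k. Q g k * r h k) = (\<Sum>\<^sub>\<infinity>k\<in>S. Q g k * r h k)"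
      by (rule infsum_cong_neutral) (use S in auto)
    finally show ?thesis using S by simp
  qed
  have "(\<Sum>\<^sub>\<infinity>k. cnj (shifted_op D (\<i> * s) u k) * u k)
      = (\<Sum>\<^sub>\<infinity>k\<in>S. cnj (shifted_op D (\<i> * s) u k) * u k)"
    by (rule infsum_cong_neutral) (use S in \<open>auto simp: Tu QR\<close>)
  also have "\<dots> = (\<Sum>k\<in>S. \<Sum>g\<in>\<Gamma>. \<Sum>h\<in>\<Gamma>. cnj (v g) * (Q g k * r h k) * v h)"
    using S(1) unfolding Tu u_def cnj_sum complex_cnj_mult QR complex_cnj_cnj sum_product
    by (simp add: mult_ac)
  also have "\<dots> = (\<Sum>g\<in>\<Gamma>. \<Sum>k\<in>S. \<Sum>h\<in>\<Gamma>. cnj (v g) * (Q g k * r h k) * v h)"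
    by (rule sum.swap)
  also have "\<dots> = (\<Sum>g\<in>\<Gamma>. \<Sum>h\<in>\<Gamma>. \<Sum>k\<in>S. cnj (v g) * (Q g k * r h k) * v h)"
    by (intro sum.cong refl sum.swap)
  also have "\<dots> = - (\<Sum>g\<in>\<Gamma>. \<Sum>h\<in>\<Gamma>. cnj (v g) * DtN_map Q R D (of_real s) g h * v h)"
    by (simp add: K sum_distrib_left sum_distrib_right sum_negf)
  finally show ?thesis using Im_inner_shifted_op_nonneg[OF u assms(3)] by simp
qed

section \<open>Energy estimate\<close>

lemma Im_hermitian_form_zero:
  fixes B :: "complex^'i^'i::finite"
  assumes "hermitian_matrix (\<lambda>i j. B $ i $ j)"
  shows "Im (\<Sum>i\<in>UNIV. cnj (x $ i) * (B *v x) $ i) = 0"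
proof -
  let ?q = "\<Sum>i\<in>UNIV. \<Sum>j\<in>UNIV. cnj (x $ i) * B $ i $ j * x $ j"
  have h: "cnj (B $ i $ j) = B $ j $ i" for i j
    using assms[unfolded hermitian_matrix_def, rule_format, of j i] by simp
  have "cnj ?q = (\<Sum>i\<in>UNIV. \<Sum>j\<in>UNIV. cnj (x $ j) * B $ j $ i * x $ i)"
    unfolding cnj_sum complex_cnj_mult h complex_cnj_cnj by (simp only: mult_ac)
  also have "\<dots> = ?q" by (rule sum.swap)
  finally have "Im (cnj ?q) = Im ?q" by (rule arg_cong)
  then have "Im ?q = 0" by (simp only: cnj.sel neg_equal_zero)
  moreover have "(\<Sum>i\<in>UNIV. cnj (x $ i) * (B *v x) $ i) = ?q"
    by (simp add: matrix_vector_mult_def sum_distrib_left mult.assoc)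
  ultimately show ?thesis by (simp only:)
qed

text \<open>The real inner product is the real part of the Hermitian one, and the factor
  \<open>- \<i>\<close> turns that real part into an imaginary part.\<close>

lemma inner_minus_i_scale:
  fixes x y :: "complex^'i::finite"
  shows "x \<bullet> (- \<i> *s y) = Im (\<Sum>i\<in>UNIV. cnj (x $ i) * y $ i)"
  by (simp add: inner_vec_def inner_complex_def algebra_simps)

text \<open>The matrix is \<open>M\<close> padded by zeros, so the form sees only entries with both
  indices in \<Gamma>, those that the theorem prescribes.\<close>

lemma Et_M_E_form:
  fixes x :: "complex^'i::finite"
  shows "(\<Sum>i\<in>UNIV. cnj (x $ i) * (Et_M_E \<Gamma> M *v x) $ i)
       = (\<Sum>g\<in>\<Gamma>. \<Sum>h\<in>\<Gamma>. cnj (x $ g) * M g h * x $ h)"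
proof -
  have e: "Et_M_E \<Gamma> M $ i $ j = (if i \<in> \<Gamma> \<and> j \<in> \<Gamma> then M i j else 0)" for i j
    unfolding Et_M_E_def restriction_def
    by (auto simp: mult_delta_left mult_delta_right intro!: sum.neutral)
  have "(\<Sum>i\<in>UNIV. cnj (x $ i) * (Et_M_E \<Gamma> M *v x) $ i)
      = (\<Sum>i\<in>UNIV. if i \<in> \<Gamma> then \<Sum>j\<in>UNIV. if j \<in> \<Gamma> then cnj (x $ i) * M i j * x $ j else 0 else 0)"
    unfolding matrix_vector_mult_def
    by (auto simp: e sum_distrib_left mult_ac intro!: sum.cong)
  then show ?thesis by (simp add: sum.inter_restrict[symmetric])
qed

text \<open>The squared norm is a Lyapunov function with derivative
  \<open>2 * (x \<bullet> f x)\<close>. It never increases, so \<delta> = \<epsilon> works for every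
  \<open>T\<close>.\<close>

lemma lyapunov_stable_if_dissipative:
  fixes f :: "'a::real_inner \<Rightarrow> 'a"
  assumes "f 0 = 0" and diss: "\<And>x. x \<bullet> f x \<le> 0"
  shows "lyapunov_stable_at_0 f"
proof -
  have decr: "norm (x t) \<le> norm (x 0)" if sol: "is_solution f T x" and t: "t \<in> {0..<T}" for T x t
  proof -
    have D: "(x has_vector_derivative f (x r)) (at r within {0..<T})" if "r \<in> {0..<T}" for r
      using sol that unfolding is_solution_def by blast
    have "x t \<bullet> x t \<le> x 0 \<bullet> x 0"
    \<comment> \<open>At time 0 the derivative is one-sided, so this criterion is chosen: it asks
      for derivatives only at interior times and for continuity up to the ends.\<close>
    proof (rule DERIV_nonpos_imp_decreasing_open[of 0 t "\<lambda>r. x r \<bullet> x r"])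
      show "0 \<le> t" using t by simp
      fix r assume r: "0 < r" "r < t"
      then have "at r within {0..<T} = at r"
        using t by (intro at_within_interior interiorI[of "{0<..<T}"]) auto
      with D[of r] r t have "(x has_vector_derivative f (x r)) (at r)" by auto
      then have "(x has_derivative (\<lambda>h. h *\<^sub>R f (x r))) (at r)"
        by (simp add: has_vector_derivative_def)
      then have "((\<lambda>r. x r \<bullet> x r) has_derivative (\<lambda>h. x r \<bullet> h *\<^sub>R f (x r) + h *\<^sub>R f (x r) \<bullet> x r)) (at r)"
        by (intro has_derivative_inner)
      then have "DERIV (\<lambda>r. x r \<bullet> x r) r :> 2 * (x r \<bullet> f (x r))"
        unfolding has_field_derivative_def
        by (rule has_derivative_eq_rhs) (auto simp: fun_eq_iff inner_commute)
      then show "\<exists>y. DERIV (\<lambda>r. x r \<bullet> x r) r :> y \<and> y \<le> 0"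
        using diss[of "x r"] by (auto intro!: exI[of _ "2 * (x r \<bullet> f (x r))"])
    next
      have "continuous_on {0..<T} x"
        unfolding continuous_on_eq_continuous_within
        by (intro ballI has_vector_derivative_continuous[OF D])
      then have "continuous_on {0..t} x" by (rule continuous_on_subset) (use t in auto)
      then show "continuous_on {0..t} (\<lambda>r. x r \<bullet> x r)" by (intro continuous_on_inner)
    qed
    then show ?thesis by (simp add: norm_eq_sqrt_inner)
  qed
  show ?thesis unfolding lyapunov_stable_at_0_def
  proof (intro conjI allI impI)
    fix \<epsilon> :: real assume "\<epsilon> > 0"
    moreover have "\<forall>T>0. \<forall>x. is_solution f T x \<and> norm (x 0) < \<epsilon> \<longrightarrow> (\<forall>t\<in>{0..<T}. norm (x t) < \<epsilon>)"
      by (auto intro: order_le_less_trans[OF decr])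
    ultimately show "\<exists>\<delta>>0. \<forall>T>0. \<forall>x. is_solution f T x \<and> norm (x 0) < \<delta> \<longrightarrow>
        (\<forall>t\<in>{0..<T}. norm (x t) < \<epsilon>)" by blast
  qed (rule assms(1))
qed

theorem mainTheorem1:
  fixes H_I_I :: "complex^'i \<Rightarrow> complex^'i^'i::finite"
    and H_I_II :: "'i \<Rightarrow> 'e \<Rightarrow> complex"
    and H_II_I :: "'e \<Rightarrow> 'i \<Rightarrow> complex"
    and H_II_II :: "'e \<Rightarrow> 'e \<Rightarrow> complex"
    and M :: "'i \<Rightarrow> 'i \<Rightarrow> complex"
    and s\<^sub>0 :: real
  defines "H \<equiv> \<lambda>\<phi>. block_matrix (\<lambda>i j. H_I_I \<phi> $ i $ j) H_I_II H_II_I H_II_II"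
    and "\<Gamma> \<equiv> boundary_set H_I_II"
  assumes "\<forall>\<phi>. hermitian_matrix (H \<phi>)"
    and "\<forall>\<phi>. finite_difference_matrix (H \<phi>)"
    and "0 \<le> s\<^sub>0"
    and "s\<^sub>0 = 0 \<longrightarrow> shifted_op_invertible H_II_II 0"
    and "\<forall>g\<in>\<Gamma>. \<forall>h\<in>\<Gamma>. M g h = DtN_map H_I_II H_II_I H_II_II (of_real s\<^sub>0) g h"
  shows "lyapunov_stable_at_0 (zeroth_order_rhs H_I_I \<Gamma> M)"
proof (rule lyapunov_stable_if_dissipative)
  show "zeroth_order_rhs H_I_I \<Gamma> M 0 = 0" by (simp add: zeroth_order_rhs_def)
  fix x :: "complex^'i"
  have "hermitian_matrix (\<lambda>i j. H_I_I x $ i $ j)"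
    unfolding hermitian_matrix_def
  proof (intro allI)
    show "H_I_I x $ i $ j = cnj (H_I_I x $ j $ i)" for i j
      using assms(3)[unfolded H_def hermitian_matrix_def, rule_format, of x "Inl i" "Inl j"] by simp
  qed
  then have "x \<bullet> (- \<i> *s (H_I_I x *v x)) = 0"
    by (simp only: inner_minus_i_scale Im_hermitian_form_zero)
  moreover have "x \<bullet> (- \<i> *s (Et_M_E \<Gamma> M *v x))
      = Im (\<Sum>g\<in>\<Gamma>. \<Sum>h\<in>\<Gamma>. cnj (x $ g) * DtN_map H_I_II H_II_I H_II_II (of_real s\<^sub>0) g h * x $ h)"
    unfolding inner_minus_i_scale Et_M_E_form using assms(7) by (intro arg_cong[of _ _ Im] sum.cong) auto
  \<comment> \<open>The coupling and exterior blocks are the same at every state; the estimate is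
    invoked with the interior block at the current \<open>x\<close>.\<close>
  moreover have "\<dots> \<le> 0"
    using assms(3,4) unfolding H_def by (intro Im_DtN_form_nonpos assms(5,6)) auto
  moreover have "zeroth_order_rhs H_I_I \<Gamma> M x
      = - \<i> *s (H_I_I x *v x) + (- \<i> *s (Et_M_E \<Gamma> M *v x))"
    by (simp add: zeroth_order_rhs_def vec_eq_iff)
  ultimately show "x \<bullet> zeroth_order_rhs H_I_I \<Gamma> M x \<le> 0"
    by (simp only: inner_add_right)
qed

end
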